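(* Let $\{V_k(x,t)\}_{k\ge 0,\,t\ge0}$ be a Lévy-Sheffer system with generating function $$\sum_{k\ge0}V_k(x,t)\frac{z^k}{k!}=(g(z))^t\exp\{x\,u(z)\}.$$ Let $\alpha$ and $\gamma$ be the umbrae with generating functions $f(\alpha,z)=g(z)$ and $f(\gamma,z)=1+u(z)$. Then for all nonnegative integers $k$ and all $t\ge0$ $$V_k(x,t)=\sum_{i=0}^k E[(x+t\mathbf{.}\beta\mathbf{.}\kappa)^i]\,B_{k,i}(g_1,\ldots,g_{k-i+1}),$$ where $g_j=E[\gamma^j]$ for all nonnegative $j$, $\kappa$ is the cumulant umbra of $\alpha\mathbf{.}\beta\mathbf{.}\gamma^{<-1>}$, $\gamma^{<-1>}$ is the compositional inverse of the umbra $\gamma$, and $B_{k,i}$ are the partial exponential Bell polynomials.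
   Context: Lévy-Sheffer system: a sequence of polynomials $V_k(x,t)$ in $x$, $t\ge0$, defined by the generating function $\sum_{k\ge0}V_k(x,t)z^k/k!=(g(z))^t\exp\{xu(z)\}$, where $g$ and $u$ are analytic in a neighborhood of $z=0$, $u(0)=0$, $g(0)=1$, $u'(0)\ne0$, and $1/g(\tau(z))$ is an infinitely divisible moment generating function, with $\tau$ such that $\tau(u(z))=z$. An umbra $\alpha$ is a symbol representing a sequence $a_0=1,a_1,a_2,\ldots$ of real numbers through a linear evaluation functional $E$ with $E[\alpha^n]=a_n$ (the $n$-th moment); $E$ is linear over $\mathbb{R}[x]$ and $E[1]=1$. Its generating function is the formal power series $f(\alpha,z)=\sum_{n\ge0}a_nz^n/n!$. Two umbrae are similar ($\equiv$) if they have the same moments. The composition umbra $\alpha\mathbf{.}\beta\mathbf{.}\gamma$ is the auxiliary umbra with generating function $f(\alpha,f(\gamma,z)-1)$. The singleton umbra $\chi$ has $f(\chi,z)=1+z$. If $E[\gamma]\ne0$, the compositional inverse $\gamma^{<-1>}$ is the umbra with $\gamma\mathbf{.}\beta\mathbf{.}\gamma^{<-1>}\equiv\gamma^{<-1>}\mathbf{.}\beta\mathbf{.}\gamma\equiv\chi$. The cumulant umbra $\kappa_\rho$ of an umbra $\rho$ is the umbra with $f(\rho,z)=\exp[f(\kappa_\rho,z)-1]$. For $t\in\mathbb{R}$ and an umbra $\kappa$, $t\mathbf{.}\beta\mathbf{.}\kappa$ is the auxiliary umbra with generating function $\exp[t(f(\kappa,z)-1)]$; powers of $x+t\mathbf{.}\beta\mathbf{.}\kappa$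 are expanded by the binomial theorem and evaluated linearly with $E$. Conventions: $B_{0,0}=1$ and $B_{k,0}=0$ for $k\ge1$. *)

theory Defs
  imports "HOL-Probability.Probability" "HOL-Complex_Analysis.Complex_Analysis"
begin

section \<open>Umbrae\<close>

text \<open>
  An umbra is identified with its sequence of moments \<open>E[\<alpha>\<^sup>n]\<close>. Similar umbrae are therefore
  equal, and the auxiliary umbrae below, which the classical umbral calculus introduces only
  up to similarity, become functions of their arguments.
\<close>

typedef umbra = "{a :: nat \<Rightarrow> real. a 0 = 1}"
  morphisms moment Abs_umbra
  by (rule exI[of _ "\<lambda>_. 1"]) simp

definition umbra_gf :: "umbra \<Rightarrow> real fps" where
  "umbra_gf \<alpha> = Abs_fps (\<lambda>n. moment \<alpha> n / fact n)"

text \<open>Meaningful for series with constant coefficient 1.\<close>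

definition umbra_of_gf :: "real fps \<Rightarrow> umbra" where
  "umbra_of_gf F = Abs_umbra (\<lambda>n. fact n * fps_nth F n)"

text \<open>
  The evaluation functional on \<open>\<real>[x][\<alpha>]\<close>: the outer variable of the polynomial is the umbra,
  the inner one is \<open>x\<close>, and the functional is \<open>\<real>[x]\<close>-linear with \<open>\<alpha>\<^sup>n \<mapsto> E[\<alpha>\<^sup>n]\<close>.
\<close>

definition umbra_eval :: "umbra \<Rightarrow> real poly poly \<Rightarrow> real poly" where
  "umbra_eval \<alpha> p = (\<Sum>n\<le>degree p. smult (moment \<alpha> n) (coeff p n))"

text \<open>The element \<open>x + \<alpha>\<close> of \<open>\<real>[x][\<alpha>]\<close>.\<close>

definition x_plus_umbra :: "real poly poly" where
  "x_plus_umbra = [:[:0, 1:], 1:]"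

definition singleton_umbra :: umbra where
  "singleton_umbra = umbra_of_gf (1 + fps_X)"

text \<open>\<open>\<alpha>.\<beta>.\<gamma>\<close>\<close>

definition umbra_comp :: "umbra \<Rightarrow> umbra \<Rightarrow> umbra" where
  "umbra_comp \<alpha> \<gamma> = umbra_of_gf (fps_compose (umbra_gf \<alpha>) (umbra_gf \<gamma> - 1))"

text \<open>Meaningful for \<open>E[\<gamma>] \<noteq> 0\<close>.\<close>

definition umbra_inv :: "umbra \<Rightarrow> umbra" where
  "umbra_inv \<gamma> = (THE \<delta>. umbra_comp \<gamma> \<delta> = singleton_umbra \<and> umbra_comp \<delta> \<gamma> = singleton_umbra)"

definition cumulant_umbra :: "umbra \<Rightarrow> umbra" where
  "cumulant_umbra \<rho> = (THE \<kappa>. umbra_gf \<rho> = fps_compose (fps_exp 1) (umbra_gf \<kappa> - 1))"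

text \<open>\<open>t.\<beta>.\<kappa>\<close>\<close>

definition real_dot_bell :: "real \<Rightarrow> umbra \<Rightarrow> umbra" where
  "real_dot_bell t \<kappa> =
     umbra_of_gf (fps_compose (fps_exp 1) (fps_const t * (umbra_gf \<kappa> - 1)))"


section \<open>Partial exponential Bell polynomials\<close>

text \<open>
  The value of \<open>B\<^bsub>k,i\<^esub>\<close> at \<open>(x 1, \<dots>, x (k - i + 1))\<close>, for \<open>i \<le> k\<close>. The sum runs over the
  nonnegative integers \<open>j\<^sub>1, \<dots>, j\<^bsub>k-i+1\<^esub>\<close> with \<open>\<Sum>j\<^sub>l = i\<close> and \<open>\<Sum>l j\<^sub>l = k\<close>; the first condition
  already implies \<open>j\<^sub>l \<le> i\<close>, and this bound is only there to make the index set visibly finite.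
\<close>

definition bell_indices :: "nat \<Rightarrow> nat \<Rightarrow> (nat \<Rightarrow> nat) set" where
  "bell_indices k i = {j \<in> {1..k - i + 1} \<rightarrow>\<^sub>E {0..i}.
     (\<Sum>l = 1..k - i + 1. j l) = i \<and> (\<Sum>l = 1..k - i + 1. l * j l) = k}"

definition partial_bell :: "nat \<Rightarrow> nat \<Rightarrow> (nat \<Rightarrow> real) \<Rightarrow> real" where
  "partial_bell k i x = (\<Sum>j\<in>bell_indices k i.
     fact k / (\<Prod>l = 1..k - i + 1. fact (j l) * fact l ^ j l) * (\<Prod>l = 1..k - i + 1. x l ^ j l))"


section \<open>Levy-Sheffer systems\<close>

text \<open>The \<open>n\<close>-fold convolution power of \<open>N\<close> is the law of a sum of \<open>n\<close> independent copies.\<close>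

definition infinitely_divisible :: "real measure \<Rightarrow> bool" where
  "infinitely_divisible M \<longleftrightarrow> real_distribution M \<and>
     (\<forall>n\<ge>1. \<exists>N. real_distribution N \<and> M = (convolution N ^^ n) (return borel 0))"

definition infinitely_divisible_mgf :: "(complex \<Rightarrow> complex) \<Rightarrow> bool" where
  "infinitely_divisible_mgf \<phi> \<longleftrightarrow> (\<exists>M. infinitely_divisible M \<and>
     (\<forall>\<^sub>F z in nhds 0. integrable M (\<lambda>x. exp (z * of_real x)) \<and>
        \<phi> z = (LINT x|M. exp (z * of_real x))))"

text \<open>
  \<open>V k t\<close> is the polynomial \<open>V\<^sub>k(\<cdot>, t)\<close>; only its values for \<open>t \<ge> 0\<close> matter. Since \<open>g 0 = 1\<close>, the
  principal value \<open>g z powr t\<close> is analytic near 0. The function \<open>\<tau>\<close> is determined near 0, because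
  \<open>u\<close> is locally biholomorphic there.
\<close>

definition Levy_Sheffer ::
    "(nat \<Rightarrow> real \<Rightarrow> real poly) \<Rightarrow> (complex \<Rightarrow> complex) \<Rightarrow> (complex \<Rightarrow> complex) \<Rightarrow> bool" where
  "Levy_Sheffer V g u \<longleftrightarrow>
     g analytic_on {0} \<and> u analytic_on {0} \<and> u 0 = 0 \<and> g 0 = 1 \<and> deriv u 0 \<noteq> 0 \<and>
     (\<exists>\<tau>. (\<forall>\<^sub>F z in nhds 0. \<tau> (u z) = z) \<and> infinitely_divisible_mgf (\<lambda>z. 1 / g (\<tau> z))) \<and>
     (\<forall>t\<ge>0. \<forall>x. \<forall>\<^sub>F z in nhds 0.
        (\<lambda>k. of_real (poly (V k t) x) * z ^ k / fact k) sums
          (g z powr of_real t * exp (of_real x * u z)))"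

text \<open>\<open>f(\<alpha>, z) = h(z)\<close> for a function \<open>h\<close> that is analytic at 0.\<close>

definition has_umbra :: "(complex \<Rightarrow> complex) \<Rightarrow> umbra \<Rightarrow> bool" where
  "has_umbra h \<alpha> \<longleftrightarrow> h has_fps_expansion Abs_fps (\<lambda>n. of_real (fps_nth (umbra_gf \<alpha>) n))"

end

theory Submission
  imports Defs
begin

text \<open>
  Write \<open>G\<close> and \<open>1 + U\<close> for the generating functions of \<open>\<alpha>\<close> and \<open>\<gamma>\<close>, so that the inverse
  of \<open>\<gamma>\<close> has the generating function \<open>1 + W\<close> with \<open>W\<close> the compositional inverse of \<open>U\<close>. The
  cumulant umbra \<open>\<kappa>\<close> then has the generating function \<open>1 + L\<close> with \<open>L = log G \<circ> W\<close>. The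
  right-hand side is \<open>k!\<close> times the \<open>k\<close>-th coefficient of \<open>(exp (x z) exp (t L)) \<circ> U\<close>, because
  \<open>U\<^sup>i / i!\<close> is the exponential generating function of the Bell polynomials \<open>B\<^bsub>k,i\<^esub>\<close>. As
  \<open>L \<circ> U = log G\<close>, this series is \<open>exp (x U) exp (t log G)\<close>, the expansion of
  \<open>g\<^sup>t exp (x u)\<close> at 0.
\<close>

section \<open>Bell polynomials as coefficients of powers\<close>

text \<open>Induction step of the multinomial expansion: the value m at the new index is split off.
  \<open>i \<le> n\<close> keeps every m \<le> i inside \<open>{0..n}\<close>.\<close>

lemma bij_betw_PiE_insert_sum:
  fixes n :: nat
  assumes "finite A" "a \<notin> A" "i \<le> n"
  shows "bij_betw (\<lambda>(m, j). j(a := m)) (SIGMA m:{..i}. {j \<in> A \<rightarrow>\<^sub>E {0..n}. sum j A = i - m})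
    {j \<in> insert a A \<rightarrow>\<^sub>E {0..n}. sum j (insert a A) = i}"
proof -
  have upd: "sum (j(a := m)) A = sum j A" for j :: "'a \<Rightarrow> nat" and m
    by (rule sum.cong) (use assms in auto)
  show ?thesis
  proof (rule bij_betw_byWitness[where f' = "\<lambda>j. (j a, j(a := undefined))"])
    let ?S = "SIGMA m:{..i}. {j \<in> A \<rightarrow>\<^sub>E {0..n}. sum j A = i - m}"
    let ?T = "{j \<in> insert a A \<rightarrow>\<^sub>E {0..n}. sum j (insert a A) = i}"
    have "j(a := undefined) = j" if "j \<in> A \<rightarrow>\<^sub>E {0..n}" for j
      using PiE_arb[OF that assms(2)] by (simp add: fun_upd_idem)
    then show "\<forall>p\<in>?S. (\<lambda>j. (j a, j(a := undefined))) ((\<lambda>(m, j). j(a := m)) p) = p"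
      by (simp add: split_paired_all)
    show "\<forall>j\<in>?T. (\<lambda>(m, j). j(a := m)) (j a, j(a := undefined)) = j"
      by simp
    have "j(a := m) \<in> ?T" if "m \<le> i" "j \<in> A \<rightarrow>\<^sub>E {0..n}" "sum j A = i - m" for m j
    proof -
      have "j(a := m) \<in> insert a A \<rightarrow>\<^sub>E {0..n}"
        using that(1,2) assms(3) by (intro PiE_fun_upd) auto
      moreover have "sum (j(a := m)) (insert a A) = i"
        using that assms upd[of j m] by simp
      ultimately show ?thesis by simp
    qed
    then show "(\<lambda>(m, j). j(a := m)) ` ?S \<subseteq> ?T"
      by (intro image_subsetI) (simp only: split_paired_all mem_Sigma_iff mem_Collect_eq
        atMost_iff case_prod_conv)
    have "(j a, j(a := undefined)) \<in> ?S" if "j \<in> ?T" for j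
    proof -
      have "j(a := undefined) \<in> A \<rightarrow>\<^sub>E {0..n}"
        using that assms(2) by (intro fun_upd_in_PiE) simp_all
      moreover have "j a + sum (j(a := undefined)) A = i"
        using that assms upd[of j undefined] by simp
      ultimately show ?thesis by simp
    qed
    then show "(\<lambda>j. (j a, j(a := undefined))) ` ?T \<subseteq> ?S"
      by (rule image_subsetI)
  qed
qed

text \<open>For divided powers x^i/i! the binomial coefficients disappear and the theorem becomes a
  plain convolution.\<close>

lemma fps_divided_binomial:
  fixes x y :: "'a::field_char_0 fps"
  shows "fps_const (1 / fact i) * (x + y) ^ i =
    (\<Sum>m\<le>i. (fps_const (1 / fact m) * x ^ m) * (fps_const (1 / fact (i - m)) * y ^ (i - m)))"
  unfolding binomial_ring sum_distrib_left
proof (rule sum.cong)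
  fix m assume "m \<in> {..i}"
  then have "(of_nat (i choose m) :: 'a) = fact i / (fact m * fact (i - m))"
    by (simp add: binomial_fact)
  then have "1 / fact i * (of_nat (i choose m) :: 'a) = (1 / fact m) * (1 / fact (i - m))"
    by simp
  then have "fps_const (1 / fact i) * of_nat (i choose m) =
      fps_const (1 / fact m) * fps_const (1 / fact (i - m) :: 'a)"
    by (simp only: fps_of_nat[symmetric] fps_const_mult)
  then show "fps_const (1 / fact i) * (of_nat (i choose m) * x ^ m * y ^ (i - m)) =
      (fps_const (1 / fact m) * x ^ m) * (fps_const (1 / fact (i - m)) * y ^ (i - m))"
    by (simp only: mult.assoc[symmetric]) (simp only: mult_ac)
qed simp

text \<open>Induction on \<open>A\<close>, splitting off one summand. The bound \<open>n\<close> is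
  separate from \<open>i\<close>, so that the induction hypothesis applies to every i - m with the
  same range \<open>{0..n}\<close>.\<close>

lemma fps_divided_multinomial:
  fixes f :: "'b \<Rightarrow> 'a::field_char_0 fps"
  assumes "finite A"
  shows "i \<le> n \<Longrightarrow> fps_const (1 / fact i) * sum f A ^ i =
    (\<Sum>j | j \<in> A \<rightarrow>\<^sub>E {0..n} \<and> sum j A = i. \<Prod>a\<in>A. fps_const (1 / fact (j a)) * f a ^ j a)"
  using assms
proof (induction A arbitrary: i rule: finite_induct)
  case empty
  show ?case
  proof (cases "i = 0")
    case True
    have "{j. j = (\<lambda>x. undefined)} = {\<lambda>x::'b. undefined :: nat}" by auto
    with True show ?thesis by simp
  qed simp
next
  case (insert a A)
  let ?h = "\<lambda>b m. fps_const (1 / fact m) * f b ^ m"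
  let ?S = "\<lambda>m. {j \<in> A \<rightarrow>\<^sub>E {0..n}. sum j A = i - m}"
  have fin: "finite (?S m)" for m
    by (rule finite_subset[of _ "A \<rightarrow>\<^sub>E {0..n}"]) (use insert.hyps in \<open>auto intro: finite_PiE\<close>)
  have upd: "sum (j(a := m)) A = sum j A" "prod (\<lambda>b. ?h b ((j(a := m)) b)) A = prod (\<lambda>b. ?h b (j b)) A"
    for j :: "'b \<Rightarrow> nat" and m
    by (rule sum.cong prod.cong; use insert.hyps in auto)+
  have "fps_const (1 / fact i) * sum f (insert a A) ^ i =
      (\<Sum>m\<le>i. ?h a m * (\<Sum>j\<in>?S m. \<Prod>b\<in>A. ?h b (j b)))"
    using insert by (simp add: fps_divided_binomial)
  also have "\<dots> = (\<Sum>(m, j)\<in>(SIGMA m:{..i}. ?S m). ?h a m * (\<Prod>b\<in>A. ?h b (j b)))"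
    by (simp add: sum_distrib_left sum.Sigma fin)
  also have "\<dots> = (\<Sum>p\<in>(SIGMA m:{..i}. ?S m). \<Prod>b\<in>insert a A. ?h b ((\<lambda>(m, j). j(a := m)) p b))"
    using insert.hyps by (intro sum.cong) (auto simp: upd simp del: fun_upd_apply, simp)
  also have "\<dots> = (\<Sum>j | j \<in> insert a A \<rightarrow>\<^sub>E {0..n} \<and> sum j (insert a A) = i.
      \<Prod>b\<in>insert a A. ?h b (j b))"
    using sum.reindex_bij_betw[OF bij_betw_PiE_insert_sum[OF insert.hyps insert.prems(1)],
        where g = "\<lambda>j. \<Prod>b\<in>insert a A. ?h b (j b)"] .
  finally show ?case .
qed

lemma fps_power_nth_cong:
  fixes A B :: "'a::comm_ring_1 fps"
  assumes "\<And>l. l \<le> n \<Longrightarrow> A $ l = B $ l"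
  shows "m \<le> n \<Longrightarrow> (A ^ i) $ m = (B ^ i) $ m"
  by (induction i arbitrary: m) (auto simp: fps_mult_nth assms intro!: sum.cong)

text \<open>Both series are divisible by X, so coefficient k of F^i is coefficient k - i of (F/X)^i,
  which sees F only up to index k - i + 1. Hence the k - i + 1 arguments of the Bell
  polynomials.\<close>

lemma fps_power_nth_cong_0:
  fixes A B :: "'a::comm_ring_1 fps"
  assumes "A $ 0 = 0" "B $ 0 = 0" "\<And>l. l \<le> k - i + 1 \<Longrightarrow> A $ l = B $ l" "i \<le> k"
  shows "(A ^ i) $ k = (B ^ i) $ k"
proof -
  have shift: "F ^ i = fps_X ^ i * fps_shift 1 F ^ i" if "F $ 0 = 0" for F :: "'a fps"
  proof -
    have "F = fps_X * fps_shift 1 F"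
      using that by (auto simp: fps_eq_iff)
    then show ?thesis by (metis power_mult_distrib)
  qed
  have "(fps_shift 1 A ^ i) $ (k - i) = (fps_shift 1 B ^ i) $ (k - i)"
    by (rule fps_power_nth_cong[of "k - i"]) (use assms in auto)
  then show ?thesis
    unfolding shift[OF assms(1)] shift[OF assms(2)] using assms(4)
    by (simp add: fps_X_power_mult_nth)
qed

lemma partial_bell_eq_fps_power_nth:
  fixes U :: "real fps"
  assumes "i \<le> k" "U $ 0 = 0"
  shows "partial_bell k i (\<lambda>l. fact l * U $ l) = fact k / fact i * (U ^ i) $ k"
proof -
  let ?A = "{1..k - i + 1}"
  let ?f = "\<lambda>l. fps_const (U $ l) * fps_X ^ l"
  have coeff: "(sum ?f ?A) $ l = (if l \<in> ?A then U $ l else 0)" for l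
  proof -
    have "(sum ?f ?A) $ l = (\<Sum>n\<in>?A. if n = l then U $ n else 0)"
      unfolding fps_sum_nth by (intro sum.cong) auto
    then show ?thesis by (simp only: sum.delta' sum.delta finite_atLeastAtMost)
  qed
  \<comment> \<open>Cutting U down to the indices 1 to k - i + 1 leaves a finite sum, ready for the
    multinomial expansion.\<close>
  have "(U ^ i) $ k = ((sum ?f ?A) ^ i) $ k"
    by (rule fps_power_nth_cong_0; (unfold coeff)?; use assms in \<open>auto simp: Suc_le_eq\<close>)
  also have "\<dots> / fact i = (fps_const (1 / fact i) * (sum ?f ?A) ^ i) $ k"
    by simp
  also have "\<dots> = (\<Sum>j | j \<in> ?A \<rightarrow>\<^sub>E {0..i} \<and> sum j ?A = i.
      (\<Prod>l\<in>?A. fps_const (1 / fact (j l)) * ?f l ^ j l) $ k)"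
    by (subst fps_divided_multinomial[of _ i i]) (auto simp: fps_sum_nth)
  also have "\<dots> = (\<Sum>j | j \<in> ?A \<rightarrow>\<^sub>E {0..i} \<and> sum j ?A = i.
      if (\<Sum>l\<in>?A. l * j l) = k then \<Prod>l\<in>?A. (U $ l) ^ j l / fact (j l) else 0)"
  proof (rule sum.cong[OF refl])
    fix j :: "nat \<Rightarrow> nat"
    have const: "(\<Prod>l\<in>S. fps_const (c l)) = fps_const (\<Prod>l\<in>S. c l)"
      for S :: "nat set" and c :: "nat \<Rightarrow> real"
      by (induction S rule: infinite_finite_induct) auto
    have "(\<Prod>l\<in>?A. fps_const (1 / fact (j l)) * ?f l ^ j l) =
        (\<Prod>l\<in>?A. fps_const ((U $ l) ^ j l / fact (j l)) * fps_X ^ (l * j l))"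
      by (intro prod.cong) (auto simp: power_mult_distrib power_mult fps_const_power
          mult.assoc[symmetric])
    \<comment> \<open>Each product is a monomial whose degree is the sum in the last condition of
      \<open>bell_indices\<close>; taking coefficient k enforces that condition.\<close>
    also have "\<dots> = fps_const (\<Prod>l\<in>?A. (U $ l) ^ j l / fact (j l)) * fps_X ^ (\<Sum>l\<in>?A. l * j l)"
      by (simp only: prod.distrib const power_sum)
    finally show "(\<Prod>l\<in>?A. fps_const (1 / fact (j l)) * ?f l ^ j l) $ k =
        (if (\<Sum>l\<in>?A. l * j l) = k then \<Prod>l\<in>?A. (U $ l) ^ j l / fact (j l) else 0)"
      by (simp add: fps_X_power_nth del: One_nat_def)
  qed
  also have "\<dots> = (\<Sum>j\<in>bell_indices k i. \<Prod>l\<in>?A. (U $ l) ^ j l / fact (j l))"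
  proof -
    have "finite {j. j \<in> ?A \<rightarrow>\<^sub>E {0..i} \<and> sum j ?A = i}"
      by (rule finite_subset[of _ "?A \<rightarrow>\<^sub>E {0..i}"]) (auto intro: finite_PiE)
    then show ?thesis
      by (subst sum.inter_filter[symmetric])
        (auto simp: bell_indices_def intro!: sum.cong)
  qed
  finally have *: "(U ^ i) $ k / fact i =
      (\<Sum>j\<in>bell_indices k i. \<Prod>l\<in>?A. (U $ l) ^ j l / fact (j l))" .
  have "fact k / fact i * (U ^ i) $ k = fact k * ((U ^ i) $ k / fact i)"
    by simp
  also have "\<dots> = (\<Sum>j\<in>bell_indices k i. fact k * (\<Prod>l\<in>?A. (U $ l) ^ j l / fact (j l)))"
    unfolding * by (rule sum_distrib_left)
  \<comment> \<open>The factors \<open>fact l ^ j l\<close> in \<open>partial_bell\<close> cancel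
    the scaling of the arguments by \<open>fact l\<close>.\<close>
  also have "\<dots> = partial_bell k i (\<lambda>l. fact l * U $ l)"
    unfolding partial_bell_def
    by (intro sum.cong)
      (auto simp: prod_dividef prod.distrib power_mult_distrib simp del: prod.cl_ivl_Suc)
  finally show ?thesis by simp
qed

section \<open>Generating functions of umbrae\<close>

lemma umbra_gf_nth: "umbra_gf \<alpha> $ n = moment \<alpha> n / fact n"
  by (simp add: umbra_gf_def)

lemma umbra_gf_nth_0 [simp]: "umbra_gf \<alpha> $ 0 = 1"
  using moment[of \<alpha>] by (simp add: umbra_gf_nth)

lemma umbra_gf_inject: "umbra_gf \<alpha> = umbra_gf \<beta> \<longleftrightarrow> \<alpha> = \<beta>"
  by (auto simp: fps_eq_iff umbra_gf_nth moment_inject[symmetric])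

lemma umbra_gf_of_gf [simp]: "F $ 0 = 1 \<Longrightarrow> umbra_gf (umbra_of_gf F) = F"
  by (auto simp: fps_eq_iff umbra_gf_nth umbra_of_gf_def Abs_umbra_inverse)

lemma umbra_gf_comp: "umbra_gf (umbra_comp \<alpha> \<gamma>) = umbra_gf \<alpha> oo (umbra_gf \<gamma> - 1)"
  by (simp add: umbra_comp_def)

lemma umbra_gf_singleton: "umbra_gf singleton_umbra = 1 + fps_X"
  by (simp add: singleton_umbra_def)

lemma umbra_comp_eq_singleton_iff:
  "umbra_comp \<alpha> \<gamma> = singleton_umbra \<longleftrightarrow> (umbra_gf \<alpha> - 1) oo (umbra_gf \<gamma> - 1) = fps_X"
  unfolding umbra_gf_inject[symmetric] umbra_gf_comp umbra_gf_singleton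
  by (auto simp: fps_compose_sub_distrib algebra_simps)

text \<open>E[\<gamma>] is the linear coefficient of \<open>umbra_gf \<gamma> - 1\<close>. As it is
  nonzero, \<open>fps_inv\<close> supplies a witness and right cancellation its uniqueness, so the
  \<open>THE\<close> in \<open>umbra_inv\<close> is well-defined.\<close>

lemma umbra_gf_inv_compose:
  assumes "moment \<gamma> 1 \<noteq> 0"
  shows "(umbra_gf (umbra_inv \<gamma>) - 1) oo (umbra_gf \<gamma> - 1) = fps_X"
proof -
  let ?U = "umbra_gf \<gamma> - 1"
  have U: "?U $ 0 = 0" "?U $ 1 \<noteq> 0"
    using assms by (simp_all add: umbra_gf_nth[of _ 1, simplified])
  let ?P = "\<lambda>\<delta>. umbra_comp \<gamma> \<delta> = singleton_umbra \<and> umbra_comp \<delta> \<gamma> = singleton_umbra"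
  have "\<exists>!\<delta>. ?P \<delta>"
  proof
    have "fps_inv ?U $ 0 = 0"
      by (simp add: fps_inv_def)
    then show "?P (umbra_of_gf (1 + fps_inv ?U))"
      using U by (simp add: umbra_comp_eq_singleton_iff fps_inv fps_inv_right)
    fix \<delta> assume "?P \<delta>"
    then have "(umbra_gf \<delta> - 1) oo ?U = fps_inv ?U oo ?U"
      using U by (simp add: umbra_comp_eq_singleton_iff fps_inv)
    then have "umbra_gf \<delta> - 1 = fps_inv ?U"
      using fps_compose_inj_right[OF U] by blast
    then have "umbra_gf \<delta> = umbra_gf (umbra_of_gf (1 + fps_inv ?U))"
      using \<open>fps_inv ?U $ 0 = 0\<close> by (simp add: algebra_simps)
    then show "\<delta> = umbra_of_gf (1 + fps_inv ?U)"
      by (simp only: umbra_gf_inject)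
  qed
  from theI'[OF this] show ?thesis
    by (simp add: umbra_inv_def umbra_comp_eq_singleton_iff)
qed

text \<open>\<open>fps_ln 1\<close> is the series of log(1 + X), the compositional inverse of exp(X)
  - 1. Subtracting 1 provides the zero constant terms that associativity of composition
  requires.\<close>

lemma fps_exp_compose_eq_iff_ln:
  fixes L R :: "'a::field_char_0 fps"
  assumes "L $ 0 = 0" "R $ 0 = 1"
  shows "R = (fps_exp 1 oo L) \<longleftrightarrow> L = (fps_ln 1 oo (R - 1))"
proof
  let ?E = "fps_exp 1 - 1 :: 'a fps"
  have E: "fps_ln 1 oo ?E = fps_X" "?E oo fps_ln 1 = fps_X"
    using fps_inv_fps_exp_compose[of "1::'a"] by (simp_all add: fps_ln_fps_exp_inv)
  {
    assume "R = fps_exp 1 oo L"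
    then have "R - 1 = ?E oo L"
      by (simp add: fps_compose_sub_distrib)
    then have "fps_ln 1 oo (R - 1) = (fps_ln 1 oo ?E) oo L"
      using assms by (simp add: fps_compose_assoc)
    then show "L = fps_ln 1 oo (R - 1)"
      using assms by (simp add: E fps_X_fps_compose_startby0)
  next
    assume "L = fps_ln 1 oo (R - 1)"
    then have "?E oo L = (?E oo fps_ln 1) oo (R - 1)"
      using assms by (simp add: fps_compose_assoc)
    also have "\<dots> = R - 1"
      using assms by (simp only: E) (simp add: fps_X_fps_compose_startby0)
    finally show "R = fps_exp 1 oo L"
      by (simp add: fps_compose_sub_distrib)
  }
qed

lemma umbra_gf_cumulant:
  "umbra_gf (cumulant_umbra \<rho>) = 1 + (fps_ln 1 oo (umbra_gf \<rho> - 1))"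
proof -
  \<comment> \<open>The defining equation of the cumulant umbra has exactly one solution, so the
    \<open>THE\<close> evaluates.\<close>
  have iff: "umbra_gf \<rho> = fps_exp 1 oo (umbra_gf \<kappa> - 1) \<longleftrightarrow>
      \<kappa> = umbra_of_gf (1 + (fps_ln 1 oo (umbra_gf \<rho> - 1)))" for \<kappa>
    by (subst fps_exp_compose_eq_iff_ln) (auto simp: umbra_gf_inject[symmetric] algebra_simps)
  show ?thesis
    by (simp add: cumulant_umbra_def iff)
qed

lemma umbra_gf_real_dot_bell:
  "umbra_gf (real_dot_bell t \<kappa>) = fps_exp 1 oo (fps_const t * (umbra_gf \<kappa> - 1))"
  by (simp add: real_dot_bell_def)

text \<open>The binomial theorem yields a binomial convolution of moments with powers of x, hence a
  product of exponential generating functions.\<close>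

lemma poly_umbra_eval_x_plus_umbra_power:
  "poly (umbra_eval \<beta> (x_plus_umbra ^ i)) x = fact i * (fps_exp x * umbra_gf \<beta>) $ i"
proof -
  have deg: "degree (x_plus_umbra ^ i) = i"
    unfolding x_plus_umbra_def by (rule degree_linear_power)
  have "poly (umbra_eval \<beta> (x_plus_umbra ^ i)) x =
      (\<Sum>n\<le>i. moment \<beta> n * (real (i choose n) * x ^ (i - n)))"
    unfolding umbra_eval_def deg
    by (simp add: poly_sum x_plus_umbra_def coeff_linear_poly_power)
  also have "\<dots> = (\<Sum>n\<le>i. fact i * (umbra_gf \<beta> $ n * fps_exp x $ (i - n)))"
    by (intro sum.cong) (auto simp: umbra_gf_nth binomial_fact)
  also have "\<dots> = fact i * (umbra_gf \<beta> * fps_exp x) $ i"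
    by (simp add: fps_mult_nth sum_distrib_left atLeast0AtMost)
  finally show ?thesis by (simp add: mult.commute)
qed

text \<open>Faa di Bruno's formula: the i! from the evaluation cancels the 1/i! that accompanies the
  i-th power of the inner series.\<close>

lemma poly_bell_sum_eq_compose_nth:
  "poly (\<Sum>i = 0..k. smult (partial_bell k i (moment \<gamma>))
      (umbra_eval \<beta> (x_plus_umbra ^ i))) x =
    fact k * ((fps_exp x * umbra_gf \<beta>) oo (umbra_gf \<gamma> - 1)) $ k"
proof -
  let ?U = "umbra_gf \<gamma> - 1"
  \<comment> \<open>\<open>partial_bell\<close> reads its arguments only from index 1 on; at 0 the
    two sequences differ, with values 1 and 0.\<close>
  have cong: "partial_bell k i (moment \<gamma>) = partial_bell k i (\<lambda>l. fact l * ?U $ l)" for i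
    unfolding partial_bell_def
    by (intro sum.cong refl arg_cong2[where f = "(*)"] prod.cong) (auto simp: umbra_gf_nth)
  have "partial_bell k i (moment \<gamma>) = fact k / fact i * (?U ^ i) $ k" if "i \<le> k" for i
    unfolding cong by (rule partial_bell_eq_fps_power_nth) (use that in auto)
  then show ?thesis
    by (simp add: poly_sum poly_umbra_eval_x_plus_umbra_power fps_compose_nth sum_distrib_left
        mult_ac)
qed

section \<open>Complex expansions of real series\<close>

text \<open>The embedding used by \<open>has_umbra\<close>. It is injective and compatible with
  products and composition, so a complex identity descends to a real one.\<close>

definition fps_complex :: "real fps \<Rightarrow> complex fps" where
  "fps_complex F = Abs_fps (\<lambda>n. of_real (F $ n))"

lemma fps_complex_nth [simp]: "fps_complex F $ n = of_real (F $ n)"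
  by (simp add: fps_complex_def)

lemma fps_complex_inject: "fps_complex F = fps_complex G \<longleftrightarrow> F = G"
  by (simp add: fps_eq_iff)

lemma fps_complex_diff: "fps_complex (F - G) = fps_complex F - fps_complex G"
  by (simp add: fps_eq_iff)

lemma fps_complex_one: "fps_complex 1 = 1"
  by (simp add: fps_eq_iff)

lemma fps_complex_const: "fps_complex (fps_const c) = fps_const (of_real c)"
  by (simp add: fps_eq_iff)

lemma fps_complex_mult: "fps_complex (F * G) = fps_complex F * fps_complex G"
  by (simp add: fps_eq_iff fps_mult_nth)

lemma fps_complex_power: "fps_complex (F ^ n) = fps_complex F ^ n"
  by (induction n) (simp_all add: fps_complex_one fps_complex_mult)

lemma fps_complex_compose: "fps_complex (F oo G) = fps_complex F oo fps_complex G"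
  by (simp add: fps_eq_iff fps_compose_nth fps_complex_power[symmetric])

lemma fps_complex_exp: "fps_complex (fps_exp c) = fps_exp (of_real c)"
  by (simp add: fps_eq_iff)

lemma fps_complex_ln: "fps_complex (fps_ln 1) = fps_ln 1"
  by (simp add: fps_eq_iff fps_ln_nth)

lemma has_fps_expansion_Ln: "(\<lambda>z. Ln (1 + z)) has_fps_expansion fps_ln 1"
proof (rule has_fps_expansionI)
  have "\<forall>\<^sub>F z in nhds 0. z \<in> ball (0::complex) 1"
    by (rule eventually_nhds_in_open) auto
  then show "\<forall>\<^sub>F z in nhds 0. (\<lambda>n. fps_ln 1 $ n * z ^ n) sums Ln (1 + z)"
  proof eventually_elim
    case (elim z)
    \<comment> \<open>At n = 0 both terms vanish, the left one because division by zero yields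
      0.\<close>
    have "(\<lambda>n. (-1) ^ Suc n / of_nat n * z ^ n) = (\<lambda>n. fps_ln 1 $ n * z ^ n)"
      by (rule ext) (auto simp: fps_ln_nth power_eq_if)
    with Ln_series[of z] elim show ?case
      by simp
  qed
qed

lemma has_fps_expansion_powr:
  fixes G :: "complex fps"
  assumes g: "g has_fps_expansion G" and G0: "G $ 0 = 1"
  shows "(\<lambda>z. g z powr c) has_fps_expansion
    (fps_exp 1 oo (fps_const c * (fps_ln 1 oo (G - 1))))"
proof -
  have "(\<lambda>z. g z - 1) has_fps_expansion G - 1"
    by (intro has_fps_expansion_diff g has_fps_expansion_1)
  then have "((\<lambda>z. Ln (1 + z)) \<circ> (\<lambda>z. g z - 1)) has_fps_expansion (fps_ln 1 oo (G - 1))"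
    by (intro has_fps_expansion_compose has_fps_expansion_Ln) (simp_all add: G0)
  then have "(\<lambda>z. Ln (g z)) has_fps_expansion (fps_ln 1 oo (G - 1))"
    by (simp add: o_def)
  then have "(exp \<circ> (\<lambda>z. c * Ln (g z))) has_fps_expansion
      (fps_exp 1 oo (fps_const c * (fps_ln 1 oo (G - 1))))"
    by (intro has_fps_expansion_compose has_fps_expansion_exp1 has_fps_expansion_cmult_left) simp_all
  \<comment> \<open>\<open>powr\<close> is 0 at base 0, so agreement with the exponential needs g to
    be nonzero near 0; continuity and g(0) = 1 give this.\<close>
  moreover have "\<forall>\<^sub>F z in nhds 0. (exp \<circ> (\<lambda>z. c * Ln (g z))) z = g z powr c"
  proof -
    have "g 0 = 1"
      using has_fps_expansion_imp_0_eq_fps_nth_0[OF g] G0 by simp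
    moreover have "isCont g 0"
      by (rule has_fps_expansion_imp_continuous[OF g])
    ultimately have "\<forall>\<^sub>F z in nhds 0. g z \<noteq> 0"
      by (intro tendsto_imp_eventually_ne[of g 1]) (auto simp: isCont_def tendsto_nhds_iff)
    then show ?thesis
      by eventually_elim (simp add: powr_def)
  qed
  ultimately show ?thesis
    by (simp add: has_fps_expansion_cong)
qed

section \<open>Comparison of the two expansions\<close>

theorem theorem4p11:
  fixes V :: "nat \<Rightarrow> real \<Rightarrow> real poly"
    and g u :: "complex \<Rightarrow> complex"
    and \<alpha> \<gamma> \<kappa> :: umbra
  assumes "Levy_Sheffer V g u"
    and "has_umbra g \<alpha>"
    and "has_umbra (\<lambda>z. 1 + u z) \<gamma>"
    and "\<kappa> = cumulant_umbra (umbra_comp \<alpha> (umbra_inv \<gamma>))"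
  shows "\<forall>k. \<forall>t\<ge>0. V k t =
    (\<Sum>i = 0..k. smult (partial_bell k i (\<lambda>j. moment \<gamma> j))
       (umbra_eval (real_dot_bell t \<kappa>) (x_plus_umbra ^ i)))"
proof (intro allI impI)
  fix k and t :: real assume t: "t \<ge> 0"
  define G where "G = umbra_gf \<alpha>"
  define U where "U = umbra_gf \<gamma> - 1"
  define L where "L = umbra_gf \<kappa> - 1"
  have g: "g has_fps_expansion fps_complex G"
    using assms(2) by (simp add: has_umbra_def fps_complex_def G_def)
  have "(\<lambda>z. (1 + u z) - 1) has_fps_expansion fps_complex (umbra_gf \<gamma>) - 1"
    using assms(3) by (intro has_fps_expansion_diff has_fps_expansion_1)
      (simp add: has_umbra_def fps_complex_def)
  then have u: "u has_fps_expansion fps_complex U"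
    by (simp add: U_def fps_complex_diff fps_complex_one)
  have U0: "U $ 0 = 0" and G0: "G $ 0 = 1" and L0: "L $ 0 = 0"
    by (simp_all add: U_def G_def L_def)
  have "deriv u 0 = fps_complex U $ 1"
    using fps_nth_fps_expansion[OF u, of 1] by simp
  with assms(1) have "moment \<gamma> 1 \<noteq> 0"
    by (auto simp: Levy_Sheffer_def U_def umbra_gf_nth)
  from umbra_gf_inv_compose[OF this] have "(umbra_gf (umbra_inv \<gamma>) - 1) oo U = fps_X"
    by (simp add: U_def)
  \<comment> \<open>L is log G composed with the inverse series of U, which composition with U
    cancels.\<close>
  then have LU: "L oo U = fps_ln 1 oo (G - 1)"
    by (simp add: L_def assms(4) umbra_gf_cumulant umbra_gf_comp U0 G_def
        fps_compose_assoc[symmetric] fps_compose_sub_distrib)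
  have "poly (V k t) x = poly (\<Sum>i = 0..k. smult (partial_bell k i (moment \<gamma>))
      (umbra_eval (real_dot_bell t \<kappa>) (x_plus_umbra ^ i))) x" for x
  proof -
    define F where "F = (fps_exp 1 oo (fps_const t * (fps_ln 1 oo (G - 1)))) * (fps_exp x oo U)"
    have "(\<lambda>z. g z powr of_real t * exp (of_real x * u z)) has_fps_expansion
        (fps_exp 1 oo (fps_const (of_real t) * (fps_ln 1 oo (fps_complex G - 1)))) *
        (fps_exp (of_real x) oo fps_complex U)"
      using has_fps_expansion_compose[OF has_fps_expansion_exp u, of "of_real x"] U0 G0
      by (intro has_fps_expansion_mult has_fps_expansion_powr g) (simp_all add: o_def)
    then have "(\<lambda>z. g z powr of_real t * exp (of_real x * u z)) has_fps_expansion fps_complex F"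
      by (simp add: F_def fps_complex_mult fps_complex_compose fps_complex_exp fps_complex_ln
          fps_complex_const fps_complex_diff fps_complex_one)
    \<comment> \<open>The definition of a Levy-Sheffer system gives a second expansion of the same
      function, and Taylor coefficients are unique.\<close>
    moreover have "(\<lambda>z. g z powr of_real t * exp (of_real x * u z)) has_fps_expansion
        fps_complex (Abs_fps (\<lambda>k. poly (V k t) x / fact k))"
      using assms(1) t by (intro has_fps_expansionI) (simp add: Levy_Sheffer_def)
    ultimately have "F = Abs_fps (\<lambda>k. poly (V k t) x / fact k)"
      by (metis fps_expansion_unique_complex fps_complex_inject)
    then have "poly (V k t) x = fact k * F $ k"
      by simp
    \<comment> \<open>Composition with U is pulled out of both factors, by \<open>LU\<close> in the
      exponential of t log G.\<close>
    also have "F = (fps_exp x * (fps_exp 1 oo (fps_const t * L))) oo U"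
      by (simp add: F_def fps_compose_mult_distrib U0 L0 LU fps_compose_assoc[symmetric]
          mult.commute)
    finally show ?thesis
      by (simp only: poly_bell_sum_eq_compose_nth umbra_gf_real_dot_bell L_def U_def)
  qed
  then show "V k t = (\<Sum>i = 0..k. smult (partial_bell k i (\<lambda>j. moment \<gamma> j))
      (umbra_eval (real_dot_bell t \<kappa>) (x_plus_umbra ^ i)))"
    by (intro poly_ext) simp
qed

end
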